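(* Let $\varphi,\psi\colon\mathbb R_+\to\mathbb R_+$ be Borel functions. Let $A$ be a closed densely defined operator in a complex Hilbert space $\mathcal H$ and let $E$ be the spectral measure of $|A|$. Then the following conditions are equivalent: (i) $E(\psi^{-1}(\cdot))A\subseteq AE(\varphi^{-1}(\cdot))$; (ii) $\langle E(\psi^{-1}(\cdot))Af,Af\rangle=\langle E(\varphi^{-1}(\cdot))|A|f,|A|f\rangle$ for all $f\in\mathcal D(A)$; (iii) $\langle E(\psi^{-1}(\cdot))Af,Af\rangle\ll\langle E(\varphi^{-1}(\cdot))|A|f,|A|f\rangle$ for all $f\in\mathcal D(A)$.
   Context: All operators are linear and possibly unbounded; $\mathcal D(A)$ denotes the domain of $A$. $\mathbb R_+=[0,\infty)$ and $\mathfrak B(\mathbb R_+)$ is its Borel $\sigma$-algebra. For a closed densely defined $A$, $|A|$ is the square root of the positive selfadjoint operator $A^*A$, and its spectral measure is regarded as defined on $\mathfrak B(\mathbb R_+)$. $E(\varphi^{-1}(\cdot))$ stands for the spectral measure $\sigma\mapsto E(\varphi^{-1}(\sigma))$ on $\mathfrak B(\mathbb R_+)$, and similarly for $\psi$; relations involving $(\cdot)$ in (i) and (ii) are understood to hold for every $\sigma\in\mathfrak B(\mathbb R_+)$ (the same $\sigma$ on both sides). $S\subseteq T$ means $\mathcal D(S)\subseteq\mathcal D(T)$ and $Sf=Tf$ for $f\in\mathcal D(S)$. For finite positive Borel measures on $\mathbb R_+$, $\mu\ll\nu$ means absolute continuity of $\mu$ with respect to $\nu$. *)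

theory Defs
  imports "HOL-Analysis.Analysis"
begin

section \<open>Complex Hilbert spaces\<close>

text \<open>The inner product is linear in the first argument. Completeness is inherited from
  \<^class>\<open>banach\<close>; the norm is the one induced by the inner product.\<close>

class complex_hilbert_space = banach +
  fixes scaleC :: "complex \<Rightarrow> 'a \<Rightarrow> 'a"  (infixr "*\<^sub>C" 75)
    and cinner :: "'a \<Rightarrow> 'a \<Rightarrow> complex"
  assumes scaleC_add_right: "c *\<^sub>C (x + y) = c *\<^sub>C x + c *\<^sub>C y"
    and scaleC_add_left: "(c + d) *\<^sub>C x = c *\<^sub>C x + d *\<^sub>C x"
    and scaleC_scaleC: "c *\<^sub>C d *\<^sub>C x = (c * d) *\<^sub>C x"
    and scaleR_scaleC: "r *\<^sub>R x = complex_of_real r *\<^sub>C x"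
    and cinner_commute: "cinner x y = cnj (cinner y x)"
    and cinner_add_left: "cinner (x + y) z = cinner x z + cinner y z"
    and cinner_scaleC_left: "cinner (c *\<^sub>C x) y = c * cinner x y"
    and cinner_self_nonneg: "0 \<le> Re (cinner x x)"
    and cinner_self_eq_zero: "cinner x x = 0 \<longleftrightarrow> x = 0"
    and norm_eq_sqrt_cinner: "norm x = sqrt (Re (cinner x x))"

instantiation complex :: complex_hilbert_space
begin

definition scaleC_complex :: "complex \<Rightarrow> complex \<Rightarrow> complex"
  where "scaleC_complex c x = c * x"

definition cinner_complex :: "complex \<Rightarrow> complex \<Rightarrow> complex"
  where "cinner_complex x y = x * cnj y"

instance
proof
  fix x y z c d :: complex and r :: real
  show "c *\<^sub>C (x + y) = c *\<^sub>C x + c *\<^sub>C y" "(c + d) *\<^sub>C x = c *\<^sub>C x + d *\<^sub>C x"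
    "c *\<^sub>C d *\<^sub>C x = (c * d) *\<^sub>C x" "r *\<^sub>R x = complex_of_real r *\<^sub>C x"
    by (simp_all add: scaleC_complex_def algebra_simps scaleR_conv_of_real)
  show "cinner x y = cnj (cinner y x)" "cinner (x + y) z = cinner x z + cinner y z"
    "cinner (c *\<^sub>C x) y = c * cinner x y" "cinner x x = 0 \<longleftrightarrow> x = 0"
    by (simp_all add: scaleC_complex_def cinner_complex_def algebra_simps)
  show "0 \<le> Re (cinner x x)" by (simp add: cinner_complex_def)
  show "norm x = sqrt (Re (cinner x x))"
    by (simp add: cinner_complex_def cmod_def power2_eq_square)
qed

end

section \<open>Unbounded operators\<close>

text \<open>An operator in a Hilbert space is a partial function. For partial functions \<open>S\<close>, \<open>T\<close>,
  \<^term>\<open>dom S\<close> is the domain, \<^term>\<open>S \<subseteq>\<^sub>m T\<close> says that \<open>T\<close> extends \<open>S\<close>, and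
  \<^term>\<open>S \<circ>\<^sub>m T\<close> is the operator product with its natural domain
  (those \<open>f\<close> in \<^term>\<open>dom T\<close> with \<open>T f\<close> in \<^term>\<open>dom S\<close>).\<close>

type_synonym 'a operator = "'a \<rightharpoonup> 'a"

definition app :: "'a operator \<Rightarrow> 'a \<Rightarrow> 'a"
  where "app A f = the (A f)"

definition total_op :: "('a \<Rightarrow> 'a) \<Rightarrow> 'a operator"
  where "total_op B = (\<lambda>f. Some (B f))"

definition linear_op :: "'a::complex_hilbert_space operator \<Rightarrow> bool"
  where "linear_op A \<longleftrightarrow> 0 \<in> dom A
    \<and> (\<forall>f\<in>dom A. \<forall>g\<in>dom A. f + g \<in> dom A \<and> app A (f + g) = app A f + app A g)
    \<and> (\<forall>c. \<forall>f\<in>dom A. c *\<^sub>C f \<in> dom A \<and> app A (c *\<^sub>C f) = c *\<^sub>C app A f)"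

definition densely_defined :: "'a::topological_space operator \<Rightarrow> bool"
  where "densely_defined A \<longleftrightarrow> closure (dom A) = UNIV"

definition closed_op :: "'a::topological_space operator \<Rightarrow> bool"
  where "closed_op A \<longleftrightarrow> closed (Map.graph A)"

text \<open>The vector \<open>h\<close> below is unique when \<open>A\<close> is densely defined, the only case in which
  the adjoint is used.\<close>

definition adjoint_op :: "'a::complex_hilbert_space operator \<Rightarrow> 'a operator"
  where "adjoint_op A = (\<lambda>g.
    if \<exists>h. \<forall>f\<in>dom A. cinner (app A f) g = cinner f h
    then Some (THE h. \<forall>f\<in>dom A. cinner (app A f) g = cinner f h) else None)"

definition selfadjoint_op :: "'a::complex_hilbert_space operator \<Rightarrow> bool"
  where "selfadjoint_op T \<longleftrightarrow> linear_op T \<and> densely_defined T \<and> adjoint_op T = T"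

definition positive_op :: "'a::complex_hilbert_space operator \<Rightarrow> bool"
  where "positive_op T \<longleftrightarrow>
    (\<forall>f\<in>dom T. cinner (app T f) f \<in> \<real> \<and> 0 \<le> Re (cinner (app T f) f))"

text \<open>\<open>T\<close> is \<open>|A|\<close>, the positive selfadjoint square root of \<open>A\<^sup>*A\<close>.\<close>

definition is_modulus :: "'a::complex_hilbert_space operator \<Rightarrow> 'a operator \<Rightarrow> bool"
  where "is_modulus A T \<longleftrightarrow>
    selfadjoint_op T \<and> positive_op T \<and> T \<circ>\<^sub>m T = adjoint_op A \<circ>\<^sub>m A"

section \<open>Spectral measures on the half-line\<close>

abbreviation borel_Rplus :: "real measure"
  where "borel_Rplus \<equiv> restrict_space borel {0..}"

definition orthogonal_projection :: "('a::complex_hilbert_space \<Rightarrow> 'a) \<Rightarrow> bool"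
  where "orthogonal_projection P \<longleftrightarrow>
    (\<forall>f g. P (f + g) = P f + P g) \<and> (\<forall>c f. P (c *\<^sub>C f) = c *\<^sub>C P f)
    \<and> (\<forall>f. P (P f) = P f) \<and> (\<forall>f g. cinner (P f) g = cinner f (P g))"

text \<open>Countable additivity is in the strong operator topology. Values of \<open>E\<close> off the Borel
  subsets of the half-line are irrelevant.\<close>

definition spectral_measure :: "(real set \<Rightarrow> 'a::complex_hilbert_space \<Rightarrow> 'a) \<Rightarrow> bool"
  where "spectral_measure E \<longleftrightarrow>
    (\<forall>\<sigma>\<in>sets borel_Rplus. orthogonal_projection (E \<sigma>))
    \<and> E {0..} = id
    \<and> (\<forall>F :: nat \<Rightarrow> real set. range F \<subseteq> sets borel_Rplus \<longrightarrow> disjoint_family F \<longrightarrow>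
        (\<forall>f. (\<lambda>n. E (F n) f) sums E (\<Union>n. F n) f))"

text \<open>The measure \<open>\<sigma> \<mapsto> \<langle>E(\<sigma>)f, f\<rangle>\<close>.\<close>

definition scalar_measure ::
    "(real set \<Rightarrow> 'a::complex_hilbert_space \<Rightarrow> 'a) \<Rightarrow> 'a \<Rightarrow> real measure"
  where "scalar_measure E f =
    measure_of {0..} (sets borel_Rplus) (\<lambda>\<sigma>. ennreal (Re (cinner (E \<sigma> f) f)))"

text \<open>\<open>T\<close> is the spectral integral of \<open>x\<close> with respect to \<open>E\<close>: its domain consists of those \<open>f\<close>
  for which \<open>x\<^sup>2\<close> is integrable with respect to \<open>\<langle>E(\<cdot>)f, f\<rangle>\<close>, and on it
  \<open>\<langle>Tf, f\<rangle> = \<integral> x \<langle>E(dx)f, f\<rangle>\<close>; by polarization this determines \<open>T\<close>.\<close>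

definition spectral_measure_of ::
    "'a::complex_hilbert_space operator \<Rightarrow> (real set \<Rightarrow> 'a \<Rightarrow> 'a) \<Rightarrow> bool"
  where "spectral_measure_of T E \<longleftrightarrow> spectral_measure E
    \<and> dom T = {f. integrable (scalar_measure E f) (\<lambda>x. x\<^sup>2)}
    \<and> (\<forall>f\<in>dom T. cinner (app T f) f = complex_of_real (\<integral>x. x \<partial>scalar_measure E f))"

text \<open>\<open>E(\<phi>\<^sup>-\<^sup>1(\<cdot>))\<close>, where \<open>\<phi>\<close> is regarded as a function on the half-line only.\<close>

definition pullback ::
    "(real set \<Rightarrow> 'a \<Rightarrow> 'a) \<Rightarrow> (real \<Rightarrow> real) \<Rightarrow> real set \<Rightarrow> 'a \<Rightarrow> 'a"
  where "pullback E \<phi> \<sigma> = E (\<phi> -` \<sigma> \<inter> {0..})"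

lemma space_sets_scalar_measure [simp]:
  "space (scalar_measure E f) = {0..}" "sets (scalar_measure E f) = sets borel_Rplus"
proof -
  have *: "sets borel_Rplus \<subseteq> Pow {0..}"
    using sets.space_closed[of borel_Rplus] by (simp add: space_restrict_space)
  show "space (scalar_measure E f) = {0..}"
    unfolding scalar_measure_def using * by (rule space_measure_of)
  have "sigma_sets {0..} (sets borel_Rplus) = sets borel_Rplus"
    using sets.sigma_sets_eq[of borel_Rplus] by (simp add: space_restrict_space)
  then show "sets (scalar_measure E f) = sets borel_Rplus"
    unfolding scalar_measure_def using * by (simp add: sets_measure_of)
qed

lemma cinner_add_right:
  "cinner (x::'a::complex_hilbert_space) (y + z) = cinner x y + cinner x z"
  by (metis cinner_add_left cinner_commute complex_cnj_add)

lemma cinner_minus_left: "cinner (- (x::'a::complex_hilbert_space)) y = - cinner x y"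
  by (metis add.right_inverse add_eq_0_iff cinner_add_left add_cancel_right_right)

lemma Re_cinner_polarization:
  fixes x y :: "'a::complex_hilbert_space"
  shows "Re (cinner x y) = ((norm (x + y))\<^sup>2 - (norm (x + (- y)))\<^sup>2) / 4"
proof -
  have sq: "(norm z)\<^sup>2 = Re (cinner z z)" for z :: 'a
    by (simp add: norm_eq_sqrt_cinner cinner_self_nonneg)
  have mr: "cinner z (- y) = - cinner z y" for z :: 'a
    by (metis cinner_minus_left cinner_commute complex_cnj_minus)
  have "Re (cinner y x) = Re (cinner x y)"
    by (metis cinner_commute cnj.sel(1))
  then show ?thesis
    unfolding sq cinner_add_left cinner_add_right mr cinner_minus_left by simp
qed

lemma orthogonal_projection_nonneg:
  "orthogonal_projection P \<Longrightarrow> 0 \<le> Re (cinner (P f) f)"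
  by (metis cinner_self_nonneg orthogonal_projection_def)

lemma spectral_measure_empty:
  assumes "spectral_measure E" shows "E {} f = 0"
proof -
  have "(\<lambda>n::nat. E {} f) sums E {} f"
    using assms[unfolded spectral_measure_def, THEN conjunct2, THEN conjunct2,
        rule_format, of "\<lambda>_. {}" f]
    by (simp add: disjoint_family_on_def)
  then show ?thesis
    using summable_LIMSEQ_zero[of "\<lambda>_. E {} f"] by (simp add: sums_iff LIMSEQ_const_iff)
qed

lemma emeasure_scalar_measure:
  fixes E :: "real set \<Rightarrow> 'a::complex_hilbert_space \<Rightarrow> 'a"
  assumes E: "spectral_measure E" and \<sigma>: "\<sigma> \<in> sets borel_Rplus"
  shows "emeasure (scalar_measure E f) \<sigma> = ennreal (Re (cinner (E \<sigma> f) f))"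
proof (rule emeasure_measure_of[OF scalar_measure_def])
  let ?m = "\<lambda>\<sigma>. ennreal (Re (cinner (E \<sigma> f) f))"
  show "sets borel_Rplus \<subseteq> Pow {0..}"
    using sets.space_closed[of borel_Rplus] by (simp add: space_restrict_space)
  have z: "cinner (0::'a) f = 0" by (metis add_cancel_right_right cinner_add_left add_0)
  show "positive (sets (scalar_measure E f)) ?m"
    by (simp add: positive_def spectral_measure_empty[OF E] z)
  have nn: "0 \<le> Re (cinner (E S f) f)" if "S \<in> sets borel_Rplus" for S
    using E that by (intro orthogonal_projection_nonneg) (simp add: spectral_measure_def)
  show "countably_additive (sets (scalar_measure E f)) ?m"
  proof (rule countably_additiveI)
    fix F :: "nat \<Rightarrow> real set"
    assume F: "range F \<subseteq> sets (scalar_measure E f)" "disjoint_family F"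
    then have "(\<lambda>n. E (F n) f) sums E (\<Union>n. F n) f"
      using E by (simp add: spectral_measure_def)
    then have "(\<lambda>n. Re (cinner (\<Sum>i<n. E (F i) f) f)) \<longlonglongrightarrow> Re (cinner (E (\<Union>n. F n) f) f)"
      unfolding sums_def Re_cinner_polarization by (intro tendsto_intros) auto
    moreover have "Re (cinner (\<Sum>i<n. E (F i) f) f) = (\<Sum>i<n. Re (cinner (E (F i) f) f))"
      for n :: nat
      by (induction n) (simp_all add: z cinner_add_left)
    ultimately have "(\<lambda>n. Re (cinner (E (F n) f) f)) sums Re (cinner (E (\<Union>n. F n) f) f)"
      by (simp add: sums_def)
    moreover have "0 \<le> Re (cinner (E (F n) f) f)" for n
      using F by (intro nn) auto
    ultimately show "(\<Sum>n. ?m (F n)) = ?m (\<Union>n. F n)"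
      by (simp add: suminf_ennreal2 sums_iff)
  qed
  show "\<sigma> \<in> sets (scalar_measure E f)" using \<sigma> by simp
qed

lemma spectral_measure_pullback:
  assumes E: "spectral_measure E" and \<phi>: "\<phi> \<in> borel_Rplus \<rightarrow>\<^sub>M borel_Rplus"
  shows "spectral_measure (pullback E \<phi>)"
proof -
  have m: "\<phi> -` \<sigma> \<inter> {0..} \<in> sets borel_Rplus" if "\<sigma> \<in> sets borel_Rplus" for \<sigma>
    using measurable_sets[OF \<phi> that] by (simp add: space_restrict_space)
  have "\<phi> -` {0..} \<inter> {0..} = {0..}"
    using measurable_space[OF \<phi>] by (auto simp: space_restrict_space)
  moreover have "(\<lambda>n. pullback E \<phi> (F n) f) sums pullback E \<phi> (\<Union>n. F n) f"
    if F: "range F \<subseteq> sets borel_Rplus" "disjoint_family F" for F :: "nat \<Rightarrow> real set" and f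
  proof -
    let ?G = "\<lambda>n. \<phi> -` F n \<inter> {0..}"
    have "range ?G \<subseteq> sets borel_Rplus" using F m by blast
    moreover have "disjoint_family ?G" using F by (auto simp: disjoint_family_on_def)
    ultimately have "(\<lambda>n. E (?G n) f) sums E (\<Union>n. ?G n) f"
      using E unfolding spectral_measure_def by blast
    moreover have "(\<Union>n. ?G n) = \<phi> -` (\<Union>n. F n) \<inter> {0..}" by auto
    ultimately show ?thesis by (simp only: pullback_def)
  qed
  ultimately show ?thesis
    using E m by (auto simp: spectral_measure_def pullback_def)
qed

end

theory Submission
  imports Defs
begin

text \<open>Von Neumann's theorem that \<open>A\<^sup>*A\<close> has a domain which is a core for \<open>A\<close>, applied to both \<open>A\<close>
  and \<open>|A|\<close>, shows that these operators have the same domain and that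
  \<open>\<parallel>Af\<parallel> = \<parallel>|A|f\<parallel>\<close>. As \<open>E\<close> commutes with \<open>|A|\<close>, condition (i) gives (ii) by taking norms.
  Conversely, let (iii) hold and split \<open>f = f\<^sub>1 + f\<^sub>2\<close> with \<open>f\<^sub>1 = E(\<phi>\<^sup>-\<^sup>1(\<sigma>))f\<close>.
  The measure \<open>\<langle>E(\<phi>\<^sup>-\<^sup>1(\<cdot>))|A|f\<^sub>1, |A|f\<^sub>1\<rangle>\<close> vanishes off \<open>\<sigma>\<close>, and the one
  for \<open>f\<^sub>2\<close> vanishes on \<open>\<sigma>\<close>, so by absolute continuity \<open>E(\<psi>\<^sup>-\<^sup>1(\<sigma>))\<close> fixes \<open>Af\<^sub>1\<close> and
  annihilates \<open>Af\<^sub>2\<close>.\<close>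

section \<open>Orthogonal decomposition in Hilbert spaces\<close>

lemma cinner_zero_left [simp]: "cinner 0 (x::'a::complex_hilbert_space) = 0"
  by (metis add_cancel_right_right cinner_add_left add_0)

lemma cinner_zero_right [simp]: "cinner (x::'a::complex_hilbert_space) 0 = 0"
  by (metis cinner_commute cinner_zero_left complex_cnj_zero)

lemma cinner_minus_right: "cinner (x::'a::complex_hilbert_space) (- y) = - cinner x y"
  by (metis cinner_minus_left cinner_commute complex_cnj_minus)

lemma cinner_diff_left: "cinner (x - y) (z::'a::complex_hilbert_space) = cinner x z - cinner y z"
  using cinner_add_left[of x "- y" z] by (simp add: cinner_minus_left)

lemma cinner_diff_right: "cinner (z::'a::complex_hilbert_space) (x - y) = cinner z x - cinner z y"
  using cinner_add_right[of z x "- y"] by (simp add: cinner_minus_right)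

lemma cinner_scaleC_right: "cinner (x::'a::complex_hilbert_space) (c *\<^sub>C y) = cnj c * cinner x y"
  by (metis cinner_scaleC_left cinner_commute complex_cnj_mult)

lemma scaleC_minus_one: "(- 1) *\<^sub>C (x::'a::complex_hilbert_space) = - x"
  using scaleR_scaleC[of "- 1" x] by simp

lemma scaleC_zero_right [simp]: "c *\<^sub>C (0::'a::complex_hilbert_space) = 0"
  by (metis add_cancel_right_right add_0 scaleC_add_right)

lemma scaleC_diff_right: "c *\<^sub>C (x - y) = c *\<^sub>C x - c *\<^sub>C (y::'a::complex_hilbert_space)"
  by (metis add_diff_cancel_right' diff_add_cancel scaleC_add_right)

lemma norm_power2_eq_cinner: "(norm (x::'a::complex_hilbert_space))\<^sup>2 = Re (cinner x x)"
  by (simp add: norm_eq_sqrt_cinner cinner_self_nonneg)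

lemma cinner_self: "cinner x x = complex_of_real ((norm (x::'a::complex_hilbert_space))\<^sup>2)"
proof -
  have "Im (cinner x x) = 0"
    using arg_cong[OF cinner_commute[of x x], of Im] by simp
  then show ?thesis by (simp add: norm_power2_eq_cinner complex_eq_iff)
qed

lemma norm_scaleC: "norm (c *\<^sub>C x) = cmod c * norm (x::'a::complex_hilbert_space)"
proof -
  have "c * (cnj c * cinner x x) = of_real ((cmod c)\<^sup>2) * of_real ((norm x)\<^sup>2)"
    by (simp only: cinner_self mult.assoc[symmetric] complex_norm_square)
  then have "Re (cinner (c *\<^sub>C x) (c *\<^sub>C x)) = (cmod c)\<^sup>2 * (norm x)\<^sup>2"
    unfolding cinner_scaleC_left cinner_scaleC_right of_real_mult[symmetric]
    by (simp only: mult.left_commute[of c] Re_complex_of_real)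
  then have "(norm (c *\<^sub>C x))\<^sup>2 = (cmod c * norm x)\<^sup>2"
    by (simp only: norm_power2_eq_cinner[of "c *\<^sub>C x"] power_mult_distrib)
  then show ?thesis by simp
qed

lemma tendsto_scaleC:
  fixes l :: "'a::complex_hilbert_space"
  assumes "f \<longlonglongrightarrow> l"
  shows "(\<lambda>n. c *\<^sub>C f n) \<longlonglongrightarrow> c *\<^sub>C l"
proof -
  have "(\<lambda>n. cmod c * norm (f n - l)) \<longlonglongrightarrow> cmod c * norm (l - l)"
    by (intro tendsto_intros assms)
  then show ?thesis
    by (simp add: tendsto_iff dist_norm norm_scaleC flip: scaleC_diff_right)
qed

lemma tendsto_cinner_right:
  fixes x :: "'a::complex_hilbert_space"
  assumes "f \<longlonglongrightarrow> l"
  shows "(\<lambda>n. cinner x (f n)) \<longlonglongrightarrow> cinner x l"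
proof -
  have *: "(\<lambda>n. Re (cinner y (f n))) \<longlonglongrightarrow> Re (cinner y l)" for y
    unfolding Re_cinner_polarization by (intro tendsto_intros assms) auto
  \<comment> \<open>Rotating the first argument by \<open>- \<i>\<close> turns the imaginary part
    into a real part, for which polarization already gives continuity.\<close>
  have im: "Im (cinner x z) = Re (cinner ((- \<i>) *\<^sub>C x) z)" for z
    by (simp add: cinner_scaleC_left)
  show ?thesis
    by (intro tendsto_complex_iff[THEN iffD2] conjI) (simp_all only: im *)
qed

text \<open>Approximating \<open>x\<close> itself from \<open>D\<close> yields
  \<open>cinner x x = 0\<close>. This turns identities tested only on a dense domain into equations
  between vectors.\<close>

lemma cinner_eq_zero_dense:
  fixes x :: "'a::complex_hilbert_space"
  assumes "closure D = UNIV" and "\<And>y. y \<in> D \<Longrightarrow> cinner x y = 0"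
  shows "x = 0"
proof -
  have "x \<in> closure D" using assms(1) by simp
  then obtain s where s: "\<And>n. s n \<in> D" "s \<longlonglongrightarrow> x" by (auto simp: closure_sequential)
  have "(\<lambda>n. cinner x (s n)) \<longlonglongrightarrow> cinner x x" by (rule tendsto_cinner_right[OF s(2)])
  then have "cinner x x = 0" by (simp add: assms(2)[OF s(1)] LIMSEQ_const_iff)
  then show ?thesis by (simp add: cinner_self_eq_zero)
qed

section \<open>Best approximation in a closed subspace\<close>

lemma parallelogram_law:
  fixes x y :: "'a::complex_hilbert_space"
  shows "(norm (x + y))\<^sup>2 + (norm (x - y))\<^sup>2 = 2 * (norm x)\<^sup>2 + 2 * (norm y)\<^sup>2"
  by (simp add: norm_power2_eq_cinner cinner_add_left cinner_add_right
      cinner_diff_left cinner_diff_right)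

text \<open>First variation: with \<open>z = cinner u y\<close> and \<open>t > 0\<close>, replacing
  \<open>u\<close> by \<open>u\<close> minus \<open>t * z\<close> times \<open>y\<close> changes the
  squared norm by |z|^2 (t^2 N - 2 t). For small \<open>t\<close> this is negative unless
  \<open>z = 0\<close>.\<close>

lemma orthogonal_if_minimal:
  fixes u y :: "'a::complex_hilbert_space"
  assumes min: "\<And>c. (norm u)\<^sup>2 \<le> (norm (u - c *\<^sub>C y))\<^sup>2"
  shows "cinner u y = 0"
proof -
  define N where "N = (norm y)\<^sup>2"
  \<comment> \<open>This choice gives \<open>t * N < 1\<close> and stays meaningful for
    \<open>y = 0\<close>, so no case distinction is required.\<close>
  define t where "t = 1 / (1 + N)"
  define z where "z = cinner u y"
  have N: "0 \<le> N" by (simp add: N_def)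
  have yu: "cinner y u = cnj z" by (simp add: z_def cinner_commute[of y u])
  let ?c = "of_real t * z"
  have "cinner (u - ?c *\<^sub>C y) (u - ?c *\<^sub>C y)
      = cinner u u - cnj ?c * z - ?c * cnj z + ?c * (cnj ?c * of_real N)"
    by (simp only: cinner_diff_left cinner_diff_right cinner_scaleC_left cinner_scaleC_right
        z_def[symmetric] yu cinner_self[of y] N_def[symmetric]) (simp only: algebra_simps)
  also have "cnj ?c * z = of_real (t * (cmod z)\<^sup>2)"
    by (simp add: complex_norm_square mult_ac del: of_real_power)
  also have "?c * cnj z = of_real (t * (cmod z)\<^sup>2)"
    by (simp add: complex_norm_square mult_ac del: of_real_power)
  also have "?c * (cnj ?c * of_real N) = of_real (t\<^sup>2 * (cmod z)\<^sup>2 * N)"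
    by (simp add: complex_norm_square mult_ac power2_eq_square[of t] del: of_real_power)
  finally have "Re (cinner (u - ?c *\<^sub>C y) (u - ?c *\<^sub>C y))
      = (norm u)\<^sup>2 - 2 * t * (cmod z)\<^sup>2 + t\<^sup>2 * (cmod z)\<^sup>2 * N"
    by (simp only: minus_complex.sel plus_complex.sel Re_complex_of_real norm_power2_eq_cinner[of u])
  then have "(norm (u - ?c *\<^sub>C y))\<^sup>2
      = (norm u)\<^sup>2 - 2 * t * (cmod z)\<^sup>2 + t\<^sup>2 * (cmod z)\<^sup>2 * N"
    by (simp only: norm_power2_eq_cinner[of "u - ?c *\<^sub>C y"])
  with min[of "of_real t * z"] have "t * (cmod z)\<^sup>2 * (2 - t * N) \<le> 0"
    by (simp add: power2_eq_square algebra_simps)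
  moreover have "t > 0" "t * N < 1" using N by (simp_all add: t_def field_simps)
  ultimately have "(cmod z)\<^sup>2 \<le> 0"
    by (simp add: mult_le_0_iff)
  then show ?thesis by (simp add: z_def)
qed

text \<open>The projection theorem: a minimizing sequence for the distance from \<open>x\<close> to
  \<open>M\<close> is Cauchy, its limit \<open>m\<close> lies in \<open>M\<close>, and minimality
  makes \<open>x - m\<close> orthogonal to \<open>M\<close>.\<close>

lemma orthogonal_decomposition:
  fixes M :: "'a::complex_hilbert_space set"
  assumes cl: "closed M" and M0: "0 \<in> M"
    and Madd: "\<And>x y. x \<in> M \<Longrightarrow> y \<in> M \<Longrightarrow> x + y \<in> M"
    and Mscale: "\<And>c x. x \<in> M \<Longrightarrow> c *\<^sub>C x \<in> M"
  obtains m u where "x = m + u" "m \<in> M" "\<And>y. y \<in> M \<Longrightarrow> cinner u y = 0"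
proof -
  define S where "S = (\<lambda>m. (norm (x - m))\<^sup>2) ` M"
  define d where "d = Inf S"
  have bdd: "bdd_below S" by (rule bdd_belowI[of _ 0]) (auto simp: S_def)
  have ne: "S \<noteq> {}" using M0 by (auto simp: S_def)
  have dle: "d \<le> (norm (x - m))\<^sup>2" if "m \<in> M" for m
    unfolding d_def using that by (intro cInf_lower bdd) (auto simp: S_def)
  have "\<exists>m\<in>M. (norm (x - m))\<^sup>2 < d + inverse (real (Suc n))" for n
  proof -
    have "Inf S < d + inverse (real (Suc n))" by (simp add: d_def)
    then show ?thesis using cInf_less_iff[OF ne bdd] by (auto simp: S_def)
  qed
  then obtain s where sM: "\<And>n. s n \<in> M"
    and s: "\<And>n. (norm (x - s n))\<^sup>2 < d + inverse (real (Suc n))" by metis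
  \<comment> \<open>Half the sum of \<open>x - s n\<close> and \<open>x - s k\<close> is
    \<open>x\<close> minus a midpoint in \<open>M\<close>, so its squared norm is at least
    \<open>d\<close>. The parallelogram law then bounds the difference by the two excesses over
    \<open>d\<close>.\<close>
  have est: "(norm (s n - s k))\<^sup>2 \<le> 2 * inverse (real (Suc n)) + 2 * inverse (real (Suc k))" for n k
  proof -
    let ?m = "(1/2) *\<^sub>R (s n + s k)"
    have "?m \<in> M" unfolding scaleR_scaleC by (intro Mscale Madd sM)
    have "(x - s n) + (x - s k) = 2 *\<^sub>R (x - ?m)"
      by (simp add: algebra_simps scaleR_2)
    then have "(norm ((x - s n) + (x - s k)))\<^sup>2 = 4 * (norm (x - ?m))\<^sup>2"
      by (simp only: norm_scaleR power_mult_distrib) simp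
    moreover have "norm ((x - s n) - (x - s k)) = norm (s n - s k)"
      by (simp add: norm_minus_commute)
    ultimately show ?thesis
      using parallelogram_law[of "x - s n" "x - s k"] dle[OF \<open>?m \<in> M\<close>] s[of n] s[of k]
      by simp
  qed
  have "Cauchy s"
  proof (rule metric_CauchyI)
    fix e :: real assume "0 < e"
    then obtain N where N: "inverse (real (Suc N)) < e\<^sup>2 / 4"
      using reals_Archimedean[of "e\<^sup>2 / 4"] by auto
    have "dist (s m) (s n) < e" if "m \<ge> N" "n \<ge> N" for m n
    proof -
      have "inverse (real (Suc m)) \<le> inverse (real (Suc N))"
        "inverse (real (Suc n)) \<le> inverse (real (Suc N))"
        using that by (auto intro!: le_imp_inverse_le)
      then have "(norm (s m - s n))\<^sup>2 < e\<^sup>2" using est[of m n] N by linarith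
      then show ?thesis
        using \<open>0 < e\<close> by (simp add: dist_norm power_less_imp_less_base)
    qed
    then show "\<exists>M. \<forall>m\<ge>M. \<forall>n\<ge>M. dist (s m) (s n) < e" by blast
  qed
  then obtain m where lim: "s \<longlonglongrightarrow> m" by (auto simp: Cauchy_convergent_iff convergent_def)
  have mM: "m \<in> M" using cl sM lim by (auto simp: closed_sequential_limits)
  have "(norm (x - m))\<^sup>2 \<le> d + 0"
  proof (rule LIMSEQ_le)
    show "(\<lambda>n. (norm (x - s n))\<^sup>2) \<longlonglongrightarrow> (norm (x - m))\<^sup>2" by (intro tendsto_intros lim)
    show "(\<lambda>n. d + inverse (real (Suc n))) \<longlonglongrightarrow> d + 0"
      by (intro tendsto_intros LIMSEQ_inverse_real_of_nat)
    show "\<exists>N. \<forall>n\<ge>N. (norm (x - s n))\<^sup>2 \<le> d + inverse (real (Suc n))"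
      using s less_imp_le by blast
  qed
  then have min: "(norm (x - m))\<^sup>2 \<le> (norm (x - m - c *\<^sub>C y))\<^sup>2" if "y \<in> M" for c y
    using dle[OF Madd[OF mM Mscale[OF that, of c]]] unfolding diff_diff_add by linarith
  show ?thesis
    by (rule that[of m "x - m"]) (simp, rule mM, rule orthogonal_if_minimal, erule min)
qed

text \<open>Graphs of operators are subspaces of the Hilbert space \<open>\<H> \<oplus> \<H>\<close>.\<close>

instantiation prod :: (complex_hilbert_space, complex_hilbert_space) complex_hilbert_space
begin

definition scaleC_prod :: "complex \<Rightarrow> 'a \<times> 'b \<Rightarrow> 'a \<times> 'b"
  where "scaleC_prod c x = (c *\<^sub>C fst x, c *\<^sub>C snd x)"

definition cinner_prod :: "'a \<times> 'b \<Rightarrow> 'a \<times> 'b \<Rightarrow> complex"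
  where "cinner_prod x y = cinner (fst x) (fst y) + cinner (snd x) (snd y)"

instance
proof
  fix x y z :: "'a \<times> 'b" and c d :: complex and r :: real
  show "c *\<^sub>C (x + y) = c *\<^sub>C x + c *\<^sub>C y" "(c + d) *\<^sub>C x = c *\<^sub>C x + d *\<^sub>C x"
    "c *\<^sub>C d *\<^sub>C x = (c * d) *\<^sub>C x" "r *\<^sub>R x = complex_of_real r *\<^sub>C x"
    by (simp_all add: scaleC_prod_def prod_eq_iff scaleC_add_left scaleC_add_right
        scaleC_scaleC scaleR_scaleC)
  show "cinner x y = cnj (cinner y x)"
    unfolding cinner_prod_def by (metis cinner_commute complex_cnj_add)
  show "cinner (x + y) z = cinner x z + cinner y z"
    "cinner (c *\<^sub>C x) y = c * cinner x y"
    by (simp_all add: scaleC_prod_def cinner_prod_def cinner_add_left cinner_scaleC_left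
        algebra_simps)
  show "0 \<le> Re (cinner x x)" by (simp add: cinner_prod_def cinner_self_nonneg)
  show "cinner x x = 0 \<longleftrightarrow> x = 0"
    unfolding cinner_prod_def cinner_self of_real_add[symmetric] of_real_eq_0_iff
    by (auto simp: add_nonneg_eq_0_iff prod_eq_iff)
  show "norm x = sqrt (Re (cinner x x))"
    by (simp add: cinner_prod_def cinner_self norm_prod_def)
qed

end

section \<open>The modulus of a closed operator\<close>

lemma graph_eq_app: "Map.graph A = {(f, app A f) | f. f \<in> dom A}"
  by (auto simp: Map.graph_def app_def)

lemma linear_op_zero:
  assumes "linear_op A" shows "app A 0 = 0"
  using assms unfolding linear_op_def by (metis add_cancel_right_right add_0)

lemma linear_op_diff:
  assumes A: "linear_op A" and "f \<in> dom A" "g \<in> dom A"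
  shows "f - g \<in> dom A" "app A (f - g) = app A f - app A g"
proof -
  have g: "- g \<in> dom A" "app A (- g) = - app A g"
    using A assms(3) unfolding linear_op_def by (metis scaleC_minus_one)+
  show "f - g \<in> dom A" "app A (f - g) = app A f - app A g"
    using A assms(2) g unfolding linear_op_def by (metis diff_conv_add_uminus)+
qed

text \<open>Density makes the representing vector unique, so \<open>THE\<close> returns it, and the
  adjoint can be handled through its defining identity alone.\<close>

lemma adjoint_op_eq_Some_iff:
  fixes A :: "'a::complex_hilbert_space operator"
  assumes "densely_defined A"
  shows "adjoint_op A g = Some h \<longleftrightarrow> (\<forall>f\<in>dom A. cinner (app A f) g = cinner f h)"
proof -
  let ?P = "\<lambda>h. \<forall>f\<in>dom A. cinner (app A f) g = cinner f h"
  have uniq: "h1 = h2" if "?P h1" "?P h2" for h1 h2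
  proof -
    have "cinner f (h1 - h2) = 0" if "f \<in> dom A" for f
      using \<open>?P h1\<close> \<open>?P h2\<close> that by (simp add: cinner_diff_right)
    then have "h1 - h2 = 0"
      using assms unfolding densely_defined_def
      by (intro cinner_eq_zero_dense[of "dom A"]) (metis cinner_commute complex_cnj_zero)+
    then show ?thesis by simp
  qed
  have the: "(THE h. ?P h) = h" if "?P h" for h
    using that by (intro the_equality uniq)
  show ?thesis
  proof (cases "\<exists>h. ?P h")
    case True
    then obtain k where k: "?P k" by blast
    have "adjoint_op A g = Some k" unfolding adjoint_op_def if_P[OF True] the[OF k] ..
    then show ?thesis using uniq[OF k, of h] k by (metis option.inject)
  next
    case False
    then have "adjoint_op A g = None" unfolding adjoint_op_def by (rule if_not_P)
    with False show ?thesis by (metis option.distinct(1))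
  qed
qed

text \<open>The identity characterizing the adjoint survives limits in both components, so an
  adjoint has a closed graph; here \<open>T\<close> is its own adjoint.\<close>

lemma selfadjoint_op_closed:
  fixes T :: "'a::complex_hilbert_space operator"
  assumes "selfadjoint_op T" shows "closed_op T"
proof -
  have T: "T g = Some h \<longleftrightarrow> (\<forall>f\<in>dom T. cinner (app T f) g = cinner f h)" for g h
    using adjoint_op_eq_Some_iff[of T] assms by (metis selfadjoint_op_def)
  have "l \<in> Map.graph T" if s: "\<And>n. s n \<in> Map.graph T" and l: "s \<longlonglongrightarrow> l" for s l
  proof -
    have "cinner (app T f) (fst l) = cinner f (snd l)" if f: "f \<in> dom T" for f
    proof (rule LIMSEQ_unique)
      show "(\<lambda>n. cinner (app T f) (fst (s n))) \<longlonglongrightarrow> cinner (app T f) (fst l)"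
        by (intro tendsto_cinner_right tendsto_fst l)
      have "cinner (app T f) (fst (s n)) = cinner f (snd (s n))" for n
        using s[of n] f T by (auto simp: Map.graph_def)
      then show "(\<lambda>n. cinner (app T f) (fst (s n))) \<longlonglongrightarrow> cinner f (snd l)"
        using tendsto_cinner_right[OF tendsto_snd[OF l], of f] by simp
    qed
    then have "T (fst l) = Some (snd l)" by (simp add: T)
    then show ?thesis by (simp add: Map.graph_def prod_eq_iff)
  qed
  then show ?thesis by (auto simp: closed_op_def closed_sequential_limits)
qed

lemma graph_subspace:
  assumes A: "linear_op A"
  shows "0 \<in> Map.graph A"
    "x \<in> Map.graph A \<Longrightarrow> y \<in> Map.graph A \<Longrightarrow> x + y \<in> Map.graph A"
    "x \<in> Map.graph A \<Longrightarrow> c *\<^sub>C x \<in> Map.graph A"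
  using A linear_op_zero[OF A]
  by (auto simp: graph_eq_app linear_op_def scaleC_prod_def prod_eq_iff)

section \<open>Von Neumann's theorem on A*A\<close>

lemma adjoint_comp_dom:
  "f \<in> dom (adjoint_op A \<circ>\<^sub>m A) \<longleftrightarrow> f \<in> dom A \<and> app A f \<in> dom (adjoint_op A)"
  by (auto simp: map_comp_def app_def split: option.splits)

text \<open>Surjectivity of I + A*A. Decompose \<open>(h, 0)\<close> along the graph of
  \<open>A\<close>: the orthogonal remainder has the form \<open>(u, - app A f)\<close>, and its
  orthogonality to the graph says exactly that the adjoint sends \<open>app A f\<close> to
  \<open>u\<close>.\<close>

lemma surj_one_plus_adjoint_comp:
  fixes A :: "'a::complex_hilbert_space operator"
  assumes A: "linear_op A" "closed_op A" "densely_defined A"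
  obtains f u where "f \<in> dom A" "adjoint_op A (app A f) = Some u" "h = f + u"
proof -
  obtain m w where mw: "(h, 0) = m + w" "m \<in> Map.graph A"
    and orth: "\<And>y. y \<in> Map.graph A \<Longrightarrow> cinner w y = 0"
    using orthogonal_decomposition[OF A(2)[unfolded closed_op_def] graph_subspace[OF A(1)],
        of "(h, 0)"] by blast
  obtain f where f: "f \<in> dom A" "m = (f, app A f)" using mw(2) by (auto simp: graph_eq_app)
  have w: "h = f + fst w" "snd w = - app A f"
    using mw(1) f(2) by (auto simp: prod_eq_iff eq_neg_iff_add_eq_0 add.commute)
  have "cinner (app A g) (app A f) = cinner g (fst w)" if "g \<in> dom A" for g
  proof -
    have "cinner w (g, app A g) = 0" by (rule orth) (use that in \<open>auto simp: graph_eq_app\<close>)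
    then have "cinner (g, app A g) w = 0" by (metis cinner_commute complex_cnj_zero)
    then show ?thesis by (simp add: cinner_prod_def w(2) cinner_minus_right)
  qed
  then have "adjoint_op A (app A f) = Some (fst w)" by (simp add: adjoint_op_eq_Some_iff A)
  with f(1) w(1) that show ?thesis by blast
qed

lemma adjoint_op_linear:
  fixes A :: "'a::complex_hilbert_space operator"
  assumes "densely_defined A"
  shows "adjoint_op A 0 = Some 0"
    "adjoint_op A g = Some u \<Longrightarrow> adjoint_op A h = Some v \<Longrightarrow> adjoint_op A (g + h) = Some (u + v)"
    "adjoint_op A g = Some u \<Longrightarrow> adjoint_op A (c *\<^sub>C g) = Some (c *\<^sub>C u)"
  by (simp_all add: adjoint_op_eq_Some_iff[OF assms] cinner_add_right cinner_scaleC_right)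

lemma adjoint_comp_dom_subspace:
  fixes A :: "'a::complex_hilbert_space operator"
  assumes A: "linear_op A" "densely_defined A"
  defines "D \<equiv> dom (adjoint_op A \<circ>\<^sub>m A)"
  shows "0 \<in> D" "f \<in> D \<Longrightarrow> g \<in> D \<Longrightarrow> f + g \<in> D" "f \<in> D \<Longrightarrow> c *\<^sub>C f \<in> D"
    "f \<in> D \<Longrightarrow> g \<in> D \<Longrightarrow> f - g \<in> D"
proof -
  note D = D_def adjoint_comp_dom
  show "0 \<in> D"
    using A(1) linear_op_zero[OF A(1)] adjoint_op_linear(1)[OF A(2)]
    by (auto simp: D linear_op_def)
  show add: "f + g \<in> D" if "f \<in> D" "g \<in> D" for f g
    using that A(1) adjoint_op_linear(2)[OF A(2), of "app A f" _ "app A g"]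
    by (fastforce simp: D linear_op_def)
  show scale: "c *\<^sub>C f \<in> D" if "f \<in> D" for c f
    using that A(1) adjoint_op_linear(3)[OF A(2), of "app A f" _ c]
    by (fastforce simp: D linear_op_def)
  show "f - g \<in> D" if "f \<in> D" "g \<in> D"
    using add[OF that(1) scale[OF that(2), of "- 1"]] by (simp add: scaleC_minus_one)
qed

text \<open>Project \<open>(f, app A f)\<close> onto the closure of the restricted graph. The
  remainder is orthogonal to all \<open>(g, app A g)\<close> with \<open>g\<close> in the domain of
  A*A, so its first component is orthogonal to the range of I + A*A, which is the whole
  space.\<close>

lemma dom_adjoint_comp_core:
  fixes A :: "'a::complex_hilbert_space operator"
  assumes A: "linear_op A" "closed_op A" "densely_defined A" and f: "f \<in> dom A"
  shows "(f, app A f) \<in> closure {(g, app A g) | g. g \<in> dom (adjoint_op A \<circ>\<^sub>m A)}"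
proof -
  let ?D = "dom (adjoint_op A \<circ>\<^sub>m A)"
  define G where "G = {(g, app A g) | g. g \<in> ?D}"
  have D: "g \<in> dom A" if "g \<in> ?D" for g
    using that by (simp add: adjoint_comp_dom)
  note sub = adjoint_comp_dom_subspace[OF A(1,3)]
  have G0: "0 \<in> G"
    using sub(1) linear_op_zero[OF A(1)] by (auto simp: G_def prod_eq_iff)
  have Gadd: "x + y \<in> G" if "x \<in> G" "y \<in> G" for x y
  proof -
    obtain g h where "x = (g, app A g)" "g \<in> ?D" "y = (h, app A h)" "h \<in> ?D"
      using \<open>x \<in> G\<close> \<open>y \<in> G\<close> unfolding G_def by blast
    then have "x + y = (g + h, app A (g + h))" "g + h \<in> ?D"
      using A(1) D sub(2) by (simp_all add: linear_op_def)
    then show ?thesis unfolding G_def by blast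
  qed
  have Gscale: "c *\<^sub>C x \<in> G" if "x \<in> G" for c x
  proof -
    obtain g where "x = (g, app A g)" "g \<in> ?D"
      using \<open>x \<in> G\<close> unfolding G_def by blast
    then have "c *\<^sub>C x = (c *\<^sub>C g, app A (c *\<^sub>C g))" "c *\<^sub>C g \<in> ?D"
      using A(1) D sub(3) by (simp_all add: linear_op_def scaleC_prod_def)
    then show ?thesis unfolding G_def by blast
  qed
  have clG0: "0 \<in> closure G" using G0 closure_subset by blast
  have clGadd: "x + y \<in> closure G" if xy: "x \<in> closure G" "y \<in> closure G" for x y
  proof -
    obtain s r where "\<And>n. s n \<in> G" "s \<longlonglongrightarrow> x" "\<And>n. r n \<in> G" "r \<longlonglongrightarrow> y"
      using xy unfolding closure_sequential by blast
    then have "\<And>n. s n + r n \<in> G" "(\<lambda>n. s n + r n) \<longlonglongrightarrow> x + y"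
      by (auto intro: Gadd tendsto_add)
    then show ?thesis
      unfolding closure_sequential by (intro exI[of _ "\<lambda>n. s n + r n"]) blast
  qed
  have clGscale: "c *\<^sub>C x \<in> closure G" if x: "x \<in> closure G" for c x
  proof -
    obtain s where "\<And>n. s n \<in> G" "s \<longlonglongrightarrow> x"
      using x unfolding closure_sequential by blast
    then have "\<And>n. c *\<^sub>C s n \<in> G" "(\<lambda>n. c *\<^sub>C s n) \<longlonglongrightarrow> c *\<^sub>C x"
      by (auto intro: Gscale tendsto_scaleC)
    then show ?thesis
      unfolding closure_sequential by (intro exI[of _ "\<lambda>n. c *\<^sub>C s n"]) blast
  qed
  obtain m w where mw: "(f, app A f) = m + w" "m \<in> closure G"
    and orth: "\<And>y. y \<in> closure G \<Longrightarrow> cinner w y = 0"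
    using orthogonal_decomposition[OF closed_closure clG0 clGadd clGscale,
        of "(f, app A f)"] by blast
  \<comment> \<open>Closedness of \<open>A\<close> keeps the projection on the graph of
    \<open>A\<close>, so the remainder is again a point of that graph.\<close>
  have "closure G \<subseteq> Map.graph A"
    using A(2) unfolding closed_op_def
    by (intro closure_minimal) (auto simp: G_def adjoint_comp_dom graph_eq_app)
  then obtain k where k: "k \<in> dom A" "m = (k, app A k)" using mw(2) unfolding graph_eq_app by blast
  have w: "w = (f - k, app A (f - k))"
    using mw(1) k linear_op_diff[OF A(1) f k(1)] by (auto simp: prod_eq_iff algebra_simps)
  \<comment> \<open>Testing with the solution \<open>g\<close> of g + A*A g = f - k turns
    orthogonality into \<open>cinner (f - k) (f - k) = 0\<close>.\<close>
  obtain g u where g: "g \<in> dom A" "adjoint_op A (app A g) = Some u" "f - k = g + u"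
    using surj_one_plus_adjoint_comp[OF A] by blast
  have "cinner w (g, app A g) = 0"
    using g closure_subset[of G] by (intro orth) (auto simp: G_def adjoint_comp_dom)
  moreover have "cinner (app A (f - k)) (app A g) = cinner (f - k) u"
    using g(2) adjoint_op_eq_Some_iff[OF A(3)] linear_op_diff(1)[OF A(1) f k(1)] by blast
  ultimately have "cinner (f - k) (f - k) = 0"
    by (simp add: w cinner_prod_def g(3) cinner_add_right)
  then have "f = k" by (simp add: cinner_self_eq_zero)
  with mw(2) k(2) show ?thesis by (simp add: G_def)
qed

section \<open>Comparison of an operator with its modulus\<close>

lemma norm_app_eq_adjoint_comp:
  fixes A :: "'a::complex_hilbert_space operator"
  assumes "densely_defined A" "(adjoint_op A \<circ>\<^sub>m A) f = Some h"
  shows "f \<in> dom A" "(norm (app A f))\<^sup>2 = Re (cinner f h)"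
proof -
  have f: "f \<in> dom A" "adjoint_op A (app A f) = Some h"
    using assms(2) by (auto simp: map_comp_def app_def split: option.splits)
  show "f \<in> dom A" by (rule f)
  show "(norm (app A f))\<^sup>2 = Re (cinner f h)"
    using adjoint_op_eq_Some_iff[OF assms(1)] f unfolding norm_power2_eq_cinner by metis
qed

text \<open>Along a sequence in the common core, convergence of one image forces convergence of the other,
  because the difference of images has the same norm for both operators.\<close>

lemma dom_norm_of_same_adjoint_comp:
  fixes A B :: "'a::complex_hilbert_space operator"
  assumes A: "linear_op A" "closed_op A" "densely_defined A"
    and B: "linear_op B" "closed_op B" "densely_defined B"
    and eq: "adjoint_op A \<circ>\<^sub>m A = adjoint_op B \<circ>\<^sub>m B"
    and f: "f \<in> dom A"
  shows "f \<in> dom B \<and> norm (app B f) = norm (app A f)"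
proof -
  let ?D = "dom (adjoint_op A \<circ>\<^sub>m A)"
  have D: "g \<in> dom A" "g \<in> dom B" if "g \<in> ?D" for g
    using that adjoint_comp_dom[of g A] adjoint_comp_dom[of g B] unfolding eq by blast+
  note Ddiff = adjoint_comp_dom_subspace(4)[OF A(1,3)]
  have same: "norm (app B g) = norm (app A g)" if "g \<in> ?D" for g
  proof -
    obtain h where h: "(adjoint_op A \<circ>\<^sub>m A) g = Some h" using \<open>g \<in> ?D\<close> by blast
    have "(norm (app B g))\<^sup>2 = (norm (app A g))\<^sup>2"
      unfolding norm_app_eq_adjoint_comp(2)[OF A(3) h]
      by (rule norm_app_eq_adjoint_comp(2)[OF B(3) h[unfolded eq]])
    then show ?thesis by simp
  qed
  obtain s where s: "\<And>n. s n \<in> {(g, app A g) | g. g \<in> ?D}" "s \<longlonglongrightarrow> (f, app A f)"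
    using dom_adjoint_comp_core[OF A f] by (auto simp: closure_sequential)
  define g where "g = (\<lambda>n. fst (s n))"
  have g: "g n \<in> ?D" "s n = (g n, app A (g n))" for n
    using s(1)[of n] by (auto simp: g_def)
  have gf: "g \<longlonglongrightarrow> f" using tendsto_fst[OF s(2)] by (simp add: g_def)
  have gA: "(\<lambda>n. app A (g n)) \<longlonglongrightarrow> app A f" using tendsto_snd[OF s(2)] by (simp add: g)
  have "dist (app B (g m)) (app B (g n)) = dist (app A (g m)) (app A (g n))" for m n
    using same[OF Ddiff[OF g(1) g(1), of m n]] linear_op_diff(2)[OF A(1) D(1)[OF g(1)] D(1)[OF g(1)], of m n]
      linear_op_diff(2)[OF B(1) D(2)[OF g(1)] D(2)[OF g(1)], of m n] by (simp add: dist_norm)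
  then have "Cauchy (\<lambda>n. app B (g n))"
    using LIMSEQ_imp_Cauchy[OF gA] by (simp add: Cauchy_def)
  then obtain l where l: "(\<lambda>n. app B (g n)) \<longlonglongrightarrow> l"
    by (auto simp: Cauchy_convergent_iff convergent_def)
  have "(f, l) \<in> Map.graph B"
  proof (rule closed_sequentially[of _ "\<lambda>n. (g n, app B (g n))"])
    show "closed (Map.graph B)" using B(2) by (simp add: closed_op_def)
    show "(g n, app B (g n)) \<in> Map.graph B" for n
      using D(2)[OF g(1)] by (auto simp: graph_eq_app)
    show "(\<lambda>n. (g n, app B (g n))) \<longlonglongrightarrow> (f, l)" by (rule tendsto_Pair[OF gf l])
  qed
  then have fB: "f \<in> dom B" "app B f = l" by (auto simp: graph_eq_app)
  have "(\<lambda>n. norm (app B (g n))) \<longlonglongrightarrow> norm l" by (rule tendsto_norm[OF l])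
  then have "(\<lambda>n. norm (app A (g n))) \<longlonglongrightarrow> norm l" by (simp add: same[OF g(1)])
  with tendsto_norm[OF gA] have "norm (app A f) = norm l" by (rule LIMSEQ_unique)
  with fB show ?thesis by simp
qed

text \<open>Selfadjointness rewrites \<open>T \<circ>\<^sub>m T\<close> as T*T, so \<open>A\<close>
  and \<open>T\<close> share the same product with their adjoints; comparing them in both directions
  gives equal domains.\<close>

lemma modulus_dom_norm:
  fixes A T :: "'a::complex_hilbert_space operator"
  assumes A: "linear_op A" "closed_op A" "densely_defined A" and T: "is_modulus A T"
  shows "dom T = dom A" "f \<in> dom A \<Longrightarrow> norm (app T f) = norm (app A f)"
proof -
  have sa: "selfadjoint_op T" and "T \<circ>\<^sub>m T = adjoint_op A \<circ>\<^sub>m A"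
    using T by (simp_all add: is_modulus_def)
  then have eq: "adjoint_op T \<circ>\<^sub>m T = adjoint_op A \<circ>\<^sub>m A"
    by (simp add: selfadjoint_op_def)
  have T': "linear_op T" "closed_op T" "densely_defined T"
    using sa selfadjoint_op_closed[OF sa] by (auto simp: selfadjoint_op_def)
  show "dom T = dom A" "f \<in> dom A \<Longrightarrow> norm (app T f) = norm (app A f)"
    using dom_norm_of_same_adjoint_comp[OF A T' eq[symmetric]]
      dom_norm_of_same_adjoint_comp[OF T' A eq] by blast+
qed

section \<open>Spectral measures\<close>

lemma orthogonal_projectionD:
  assumes "orthogonal_projection P"
  shows "P (f + g) = P f + P g" "P (c *\<^sub>C f) = c *\<^sub>C P f" "P (P f) = P f"
    "cinner (P f) g = cinner f (P g)" "P 0 = 0"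
  using assms unfolding orthogonal_projection_def by (blast+, metis add_cancel_right_right add_0)

lemma Re_cinner_projection:
  "orthogonal_projection P \<Longrightarrow> Re (cinner (P f) f) = (norm (P f))\<^sup>2"
  unfolding norm_power2_eq_cinner by (metis orthogonal_projectionD(3,4))

lemma sets_borel_Rplus_Diff:
  "\<sigma> \<in> sets borel_Rplus \<Longrightarrow> {0..} - \<sigma> \<in> sets borel_Rplus"
  using sets.compl_sets[of \<sigma> borel_Rplus] by (simp add: space_restrict_space)

lemma sets_borel_Rplus_subset: "\<sigma> \<in> sets borel_Rplus \<Longrightarrow> \<sigma> \<subseteq> {0..}"
  using sets.sets_into_space[of \<sigma> borel_Rplus] by (simp add: space_restrict_space)

context
  fixes E :: "real set \<Rightarrow> 'a::complex_hilbert_space \<Rightarrow> 'a"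
  assumes E: "spectral_measure E"
begin

lemma spectral_measure_projection:
  "\<sigma> \<in> sets borel_Rplus \<Longrightarrow> orthogonal_projection (E \<sigma>)"
  using E by (simp add: spectral_measure_def)

lemma spectral_measure_Un:
  assumes "\<sigma> \<in> sets borel_Rplus" "\<tau> \<in> sets borel_Rplus" "\<sigma> \<inter> \<tau> = {}"
  shows "E (\<sigma> \<union> \<tau>) f = E \<sigma> f + E \<tau> f"
proof -
  have "range (binaryset \<sigma> \<tau>) \<subseteq> sets borel_Rplus" "disjoint_family (binaryset \<sigma> \<tau>)"
    using assms by (auto simp: range_binaryset_eq disjoint_family_on_def binaryset_def)
  then have "(\<lambda>n. E (binaryset \<sigma> \<tau> n) f) sums E (\<Union>n. binaryset \<sigma> \<tau> n) f"
    using E unfolding spectral_measure_def by blast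
  moreover have "(\<lambda>n. E (binaryset \<sigma> \<tau> n) f) sums (E \<sigma> f + E \<tau> f)"
    using sums_finite[of "{0, 1::nat}" "\<lambda>n. E (binaryset \<sigma> \<tau> n) f"]
    by (simp add: binaryset_def spectral_measure_empty[OF E])
  ultimately show ?thesis by (metis UN_binaryset_eq sums_unique2)
qed

text \<open>Write P and Q for the two projections. Since P + Q is idempotent by additivity, PQ + QP
  = 0. Multiplying by P on the left and on the right gives PQ = -PQP = QP, hence 2PQ = 0.\<close>

lemma spectral_measure_disjoint:
  assumes "\<sigma> \<in> sets borel_Rplus" "\<tau> \<in> sets borel_Rplus" "\<sigma> \<inter> \<tau> = {}"
  shows "E \<sigma> (E \<tau> f) = 0"
proof -
  note P = orthogonal_projectionD[OF spectral_measure_projection[OF assms(1)]]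
  note Q = orthogonal_projectionD[OF spectral_measure_projection[OF assms(2)]]
  have "E (\<sigma> \<union> \<tau>) (E (\<sigma> \<union> \<tau>) x) = E (\<sigma> \<union> \<tau>) x" for x
    using assms by (intro orthogonal_projectionD(3) spectral_measure_projection) auto
  then have *: "E \<sigma> (E \<tau> x) + E \<tau> (E \<sigma> x) = 0" for x
    by (simp add: spectral_measure_Un[OF assms] P Q algebra_simps)
  have "E \<sigma> (E \<tau> f) + E \<sigma> (E \<tau> (E \<sigma> f)) = 0"
    using arg_cong[OF *[of f], of "E \<sigma>"] by (simp add: P)
  moreover have "E \<sigma> (E \<tau> (E \<sigma> f)) + E \<tau> (E \<sigma> f) = 0"
    using *[of "E \<sigma> f"] by (simp add: P)
  ultimately have "E \<sigma> (E \<tau> f) = E \<tau> (E \<sigma> f)" by (metis add_right_cancel add.commute)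
  then have "2 *\<^sub>R E \<sigma> (E \<tau> f) = 0" using *[of f] by (simp add: scaleR_2)
  then show ?thesis by simp
qed

text \<open>Split both sets along their intersection; the disjoint pieces contribute
  nothing.\<close>

lemma spectral_measure_Int:
  assumes "\<sigma> \<in> sets borel_Rplus" "\<tau> \<in> sets borel_Rplus"
  shows "E \<sigma> (E \<tau> f) = E (\<sigma> \<inter> \<tau>) f"
proof -
  have m: "\<sigma> \<inter> \<tau> \<in> sets borel_Rplus" "\<sigma> - \<tau> \<in> sets borel_Rplus" "\<tau> - \<sigma> \<in> sets borel_Rplus"
    using assms by auto
  have "E \<tau> f = E (\<sigma> \<inter> \<tau>) f + E (\<tau> - \<sigma>) f"
    using spectral_measure_Un[OF m(1,3), of f] by (simp add: Int_Diff_Un Int_commute[of \<sigma>] Int_Diff_disjoint)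
  moreover have "E \<sigma> g = E (\<sigma> \<inter> \<tau>) g + E (\<sigma> - \<tau>) g" for g
    using spectral_measure_Un[OF m(1,2), of g] by (simp add: Int_Diff_Un Int_Diff_disjoint)
  moreover have "E (\<sigma> - \<tau>) (E (\<sigma> \<inter> \<tau>) f) = 0" by (intro spectral_measure_disjoint m) auto
  moreover have "E \<sigma> (E (\<tau> - \<sigma>) f) = 0" by (intro spectral_measure_disjoint m assms) auto
  ultimately show ?thesis
    by (simp add: orthogonal_projectionD[OF spectral_measure_projection] m assms)
qed

lemma spectral_measure_compl:
  assumes "\<sigma> \<in> sets borel_Rplus"
  shows "E \<sigma> f + E ({0..} - \<sigma>) f = f"
proof -
  have "\<sigma> \<union> ({0..} - \<sigma>) = {0..}" using sets_borel_Rplus_subset[OF assms] by auto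
  then show ?thesis
    using spectral_measure_Un[OF assms sets_borel_Rplus_Diff[OF assms], of f] E
    by (simp add: spectral_measure_def)
qed

text \<open>Multiplicativity reduces the form at \<open>E \<sigma> f\<close> to that of
  \<open>E (\<sigma> \<inter> \<tau>)\<close> at \<open>f\<close>. Integrals for projected vectors
  thereby become integrals against the single measure of \<open>f\<close>.\<close>

lemma scalar_measure_projection:
  assumes \<sigma>: "\<sigma> \<in> sets borel_Rplus"
  shows "scalar_measure E (E \<sigma> f)
    = density (scalar_measure E f) (\<lambda>x. ennreal (indicator \<sigma> x))"
proof (rule measure_eqI)
  fix \<tau> assume "\<tau> \<in> sets (scalar_measure E (E \<sigma> f))"
  then have \<tau>: "\<tau> \<in> sets borel_Rplus" by simp
  have i: "(indicator \<sigma> :: real \<Rightarrow> ennreal) \<in> borel_measurable (scalar_measure E f)"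
    by (rule borel_measurable_indicator) (simp add: \<sigma>)
  have "cinner (E \<tau> (E \<sigma> f)) (E \<sigma> f) = cinner (E (\<sigma> \<inter> \<tau>) f) f"
    using \<sigma> \<tau> by (simp add: orthogonal_projectionD(4)[OF spectral_measure_projection[OF \<sigma>], symmetric]
        spectral_measure_Int Int_ac)
  then show "emeasure (scalar_measure E (E \<sigma> f)) \<tau>
      = emeasure (density (scalar_measure E f) (\<lambda>x. ennreal (indicator \<sigma> x))) \<tau>"
    using \<sigma> \<tau> i by (simp add: emeasure_density emeasure_scalar_measure[OF E]
        ennreal_indicator indicator_inter_arith[symmetric])
qed simp

lemma borel_measurable_scalar_measure:
  "g \<in> borel_measurable borel \<Longrightarrow> g \<in> borel_measurable (scalar_measure E f)"
  by (subst measurable_cong_sets[of _ borel_Rplus _ borel])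
    (auto intro: measurable_restrict_space1)

lemma
  fixes g :: "real \<Rightarrow> real"
  assumes "\<sigma> \<in> sets borel_Rplus" "g \<in> borel_measurable borel"
  shows integrable_scalar_measure_projection: "integrable (scalar_measure E (E \<sigma> f)) g
      \<longleftrightarrow> integrable (scalar_measure E f) (\<lambda>x. indicator \<sigma> x *\<^sub>R g x)"
    and integral_scalar_measure_projection: "integral\<^sup>L (scalar_measure E (E \<sigma> f)) g
      = (\<integral>x. indicator \<sigma> x *\<^sub>R g x \<partial>scalar_measure E f)"
proof -
  have "(indicator \<sigma> :: real \<Rightarrow> real) \<in> borel_measurable (scalar_measure E f)"
    by (rule borel_measurable_indicator) (simp add: assms)
  note m = borel_measurable_scalar_measure[OF assms(2)] this
  show "integrable (scalar_measure E (E \<sigma> f)) g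
      \<longleftrightarrow> integrable (scalar_measure E f) (\<lambda>x. indicator \<sigma> x *\<^sub>R g x)"
    unfolding scalar_measure_projection[OF assms(1)] by (intro integrable_density m) simp
  show "integral\<^sup>L (scalar_measure E (E \<sigma> f)) g
      = (\<integral>x. indicator \<sigma> x *\<^sub>R g x \<partial>scalar_measure E f)"
    unfolding scalar_measure_projection[OF assms(1)] by (intro integral_density m) simp
qed

lemma finite_scalar_measure: "finite_measure (scalar_measure E f)"
proof
  have "{0..} \<in> sets borel_Rplus" by (metis sets.top space_restrict_space Int_UNIV_right space_borel)
  then show "emeasure (scalar_measure E f) (space (scalar_measure E f)) \<noteq> \<infinity>"
    by (simp add: emeasure_scalar_measure[OF E])
qed

text \<open>The measure of \<sigma> is the squared norm of \<open>E \<sigma> f\<close>, so absolute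
  continuity can be read as an implication between vanishing vectors.\<close>

lemma null_scalar_measure_iff:
  assumes "\<sigma> \<in> sets borel_Rplus"
  shows "\<sigma> \<in> null_sets (scalar_measure E f) \<longleftrightarrow> E \<sigma> f = 0"
  using assms by (simp add: null_sets_def emeasure_scalar_measure[OF E]
      Re_cinner_projection[OF spectral_measure_projection] ennreal_eq_0_iff)

end

text \<open>\<open>spectral_measure_of\<close> prescribes only the quadratic form of
  \<open>T\<close>. That form splits over \<sigma> and its complement without mixed terms, so
  polarization kills the off-diagonal blocks of \<open>T\<close>, which is commutation with
  \<open>E \<sigma>\<close>.\<close>

lemma spectral_integral_commute:
  fixes T :: "'a::complex_hilbert_space operator"
  assumes T: "linear_op T" "densely_defined T" and TE: "spectral_measure_of T E"
    and \<sigma>: "\<sigma> \<in> sets borel_Rplus" and f: "f \<in> dom T"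
  shows "E \<sigma> f \<in> dom T" "app T (E \<sigma> f) = E \<sigma> (app T f)"
proof -
  have E: "spectral_measure E"
    and domT: "dom T = {f. integrable (scalar_measure E f) (\<lambda>x. x\<^sup>2)}"
    and quad: "\<And>f. f \<in> dom T \<Longrightarrow> cinner (app T f) f = complex_of_real (\<integral>x. x \<partial>scalar_measure E f)"
    using TE by (auto simp: spectral_measure_of_def)
  note \<sigma>' = sets_borel_Rplus_Diff[OF \<sigma>]
  note P = orthogonal_projectionD[OF spectral_measure_projection[OF E \<sigma>]]
  note Q = orthogonal_projectionD[OF spectral_measure_projection[OF E \<sigma>']]
  have PQ: "E \<sigma> (E ({0..} - \<sigma>) g) = 0" "E ({0..} - \<sigma>) (E \<sigma> g) = 0" for g
    by (intro spectral_measure_disjoint[OF E] \<sigma> \<sigma>'; auto)+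
  have sum: "E \<sigma> g + E ({0..} - \<sigma>) g = g" for g by (rule spectral_measure_compl[OF E \<sigma>])
  have sub: "E \<tau> g \<in> dom T" if \<tau>: "\<tau> \<in> sets borel_Rplus" and "g \<in> dom T" for g \<tau>
    using that integrable_mult_indicator[of \<tau> "scalar_measure E g" "\<lambda>x. x\<^sup>2"]
    by (simp add: domT integrable_scalar_measure_projection[OF E])
  have int: "cinner (app T (E \<tau> g)) (E \<tau> g)
      = complex_of_real (\<integral>x. indicator \<tau> x *\<^sub>R x \<partial>scalar_measure E g)"
    if \<tau>: "\<tau> \<in> sets borel_Rplus" and g: "g \<in> dom T" for g \<tau>
    unfolding quad[OF sub[OF \<tau> g]] by (simp add: integral_scalar_measure_projection[OF E \<tau>])
  have split: "cinner (app T g) g = cinner (app T (E \<sigma> g)) (E \<sigma> g)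
      + cinner (app T (E ({0..} - \<sigma>) g)) (E ({0..} - \<sigma>) g)" if g: "g \<in> dom T" for g
  proof -
    let ?\<mu> = "scalar_measure E g"
    interpret finite_measure ?\<mu> by (rule finite_scalar_measure[OF E])
    \<comment> \<open>The function 1 + x^2 dominates |x|; it is integrable because the measure is
      finite and \<open>g\<close> lies in the domain. This licenses additivity of the integral of
      x.\<close>
    have sq: "integrable ?\<mu> (\<lambda>x. 1 + x\<^sup>2)" using g by (simp add: domT)
    have "\<bar>x\<bar> \<le> \<bar>1 + x\<^sup>2\<bar>" for x :: real
      using sum_power2_ge_zero[of "\<bar>x\<bar> - 1" 0] by (simp add: power2_eq_square algebra_simps)
    then have x: "integrable ?\<mu> (\<lambda>x. x)"
      by (intro Bochner_Integration.integrable_bound[OF sq])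
        (auto intro: borel_measurable_scalar_measure[OF E])
    have "(\<integral>x. x \<partial>?\<mu>)
        = (\<integral>x. indicator \<sigma> x *\<^sub>R x + indicator ({0..} - \<sigma>) x *\<^sub>R x \<partial>?\<mu>)"
      by (intro Bochner_Integration.integral_cong) (auto simp: indicator_def)
    also have "\<dots> = (\<integral>x. indicator \<sigma> x *\<^sub>R x \<partial>?\<mu>) + (\<integral>x. indicator ({0..} - \<sigma>) x *\<^sub>R x \<partial>?\<mu>)"
      using \<sigma> \<sigma>' x by (intro Bochner_Integration.integral_add integrable_mult_indicator) auto
    finally show ?thesis by (simp only: quad[OF g] int[OF \<sigma> g] int[OF \<sigma>' g] of_real_add)
  qed
  have cross: "cinner (app T (E \<sigma> g)) (E ({0..} - \<sigma>) h) = 0"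
    "cinner (app T (E ({0..} - \<sigma>) h)) (E \<sigma> g) = 0" if g: "g \<in> dom T" and h: "h \<in> dom T" for g h
  proof -
    let ?u = "E \<sigma> g" and ?v = "E ({0..} - \<sigma>) h"
    have uv: "?u \<in> dom T" "?v \<in> dom T" using sub \<sigma> \<sigma>' g h by auto
    \<comment> \<open>Apply \<open>split\<close> to \<open>?u + c *\<^sub>C ?v\<close>, whose two
      spectral components are \<open>?u\<close> and \<open>c *\<^sub>C ?v\<close>: the diagonal
      terms cancel and only the mixed ones remain.\<close>
    have "cnj c * cinner (app T ?u) ?v + c * cinner (app T ?v) ?u = 0" for c
    proof -
      have cv: "c *\<^sub>C ?v \<in> dom T" "app T (c *\<^sub>C ?v) = c *\<^sub>C app T ?v"
        using T(1) uv by (auto simp: linear_op_def)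
      have s: "?u + c *\<^sub>C ?v \<in> dom T" "app T (?u + c *\<^sub>C ?v) = app T ?u + c *\<^sub>C app T ?v"
        using T(1) uv cv by (auto simp: linear_op_def)
      have "E \<sigma> (?u + c *\<^sub>C ?v) = ?u" "E ({0..} - \<sigma>) (?u + c *\<^sub>C ?v) = c *\<^sub>C ?v"
        by (simp_all add: P Q PQ)
      then show ?thesis
        using split[OF s(1)]
        by (simp add: s cv cinner_add_left cinner_add_right cinner_scaleC_left
            cinner_scaleC_right algebra_simps)
    qed
    \<comment> \<open>With a and b the mixed terms, these two choices give a + b = 0 and b - a =
      0.\<close>
    from this[of 1] this[of \<i>] show "cinner (app T ?u) ?v = 0" "cinner (app T ?v) ?u = 0"
      by (auto simp: complex_eq_iff)
  qed
  show "E \<sigma> f \<in> dom T" by (rule sub[OF \<sigma> f])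
  let ?u = "E \<sigma> f" and ?v = "E ({0..} - \<sigma>) f"
  \<comment> \<open>Moving the projection to the other argument turns \<open>cross\<close> into
    orthogonality to the dense domain of \<open>T\<close>.\<close>
  have 1: "E ({0..} - \<sigma>) (app T ?u) = 0"
    using T(2) cross(1)[OF f] unfolding densely_defined_def
    by (intro cinner_eq_zero_dense[of "dom T"]) (auto simp: Q)
  have 2: "E \<sigma> (app T ?v) = 0"
    using T(2) cross(2)[OF _ f] unfolding densely_defined_def
    by (intro cinner_eq_zero_dense[of "dom T"]) (auto simp: P)
  have "app T f = app T ?u + app T ?v"
    using T(1) sub[OF \<sigma> f] sub[OF \<sigma>' f] sum[of f] unfolding linear_op_def by metis
  then have "E \<sigma> (app T f) = E \<sigma> (app T ?u)" by (simp add: P 2)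
  then show "app T ?u = E \<sigma> (app T f)" using sum[of "app T ?u"] 1 by simp
qed

section \<open>Equivalence of the three conditions\<close>

theorem theorem9p2:
  fixes \<phi> \<psi> :: "real \<Rightarrow> real"
    and A absA :: "'a::complex_hilbert_space operator"
    and E :: "real set \<Rightarrow> 'a \<Rightarrow> 'a"
  assumes "\<phi> \<in> borel_Rplus \<rightarrow>\<^sub>M borel_Rplus"
    and "\<psi> \<in> borel_Rplus \<rightarrow>\<^sub>M borel_Rplus"
    and "linear_op A" and "closed_op A" and "densely_defined A"
    and "is_modulus A absA"
    and "spectral_measure_of absA E"
  defines "cond_i \<equiv> \<forall>\<sigma>\<in>sets borel_Rplus.
      total_op (pullback E \<psi> \<sigma>) \<circ>\<^sub>m A \<subseteq>\<^sub>m A \<circ>\<^sub>m total_op (pullback E \<phi> \<sigma>)"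
    and "cond_ii \<equiv> \<forall>f\<in>dom A. \<forall>\<sigma>\<in>sets borel_Rplus.
      cinner (pullback E \<psi> \<sigma> (app A f)) (app A f)
        = cinner (pullback E \<phi> \<sigma> (app absA f)) (app absA f)"
    and "cond_iii \<equiv> \<forall>f\<in>dom A.
      absolutely_continuous (scalar_measure (pullback E \<phi>) (app absA f))
        (scalar_measure (pullback E \<psi>) (app A f))"
  shows "(cond_i \<longleftrightarrow> cond_ii) \<and> (cond_ii \<longleftrightarrow> cond_iii)"
proof -
  let ?E\<phi> = "pullback E \<phi>" and ?E\<psi> = "pullback E \<psi>"
  have T: "linear_op absA" "densely_defined absA"
    using assms(6) by (simp_all add: is_modulus_def selfadjoint_op_def)
  have E: "spectral_measure E" using assms(7) by (simp add: spectral_measure_of_def)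
  note E\<phi> = spectral_measure_pullback[OF E assms(1)]
  note E\<psi> = spectral_measure_pullback[OF E assms(2)]
  note P\<psi> = orthogonal_projectionD[OF spectral_measure_projection[OF E\<psi>]]
  note dom = modulus_dom_norm(1)[OF assms(3-6)]
  note norm = modulus_dom_norm(2)[OF assms(3-6)]
  have commute: "?E\<phi> \<sigma> f \<in> dom A" "app absA (?E\<phi> \<sigma> f) = ?E\<phi> \<sigma> (app absA f)"
    if "\<sigma> \<in> sets borel_Rplus" "f \<in> dom A" for \<sigma> f
  proof -
    have "\<phi> -` \<sigma> \<inter> {0..} \<in> sets borel_Rplus"
      using measurable_sets[OF assms(1) that(1)] by (simp add: space_restrict_space)
    from spectral_integral_commute[OF T assms(7) this, of f] that(2)
    show "?E\<phi> \<sigma> f \<in> dom A" "app absA (?E\<phi> \<sigma> f) = ?E\<phi> \<sigma> (app absA f)"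
      by (auto simp: pullback_def dom)
  qed
  \<comment> \<open>The pulled-back projections are everywhere defined, so the left product has
    domain \<open>dom A\<close> and the operator inclusion becomes a pointwise statement.\<close>
  have i_iff: "cond_i \<longleftrightarrow> (\<forall>\<sigma>\<in>sets borel_Rplus. \<forall>f\<in>dom A.
      ?E\<phi> \<sigma> f \<in> dom A \<and> app A (?E\<phi> \<sigma> f) = ?E\<psi> \<sigma> (app A f))"
    unfolding cond_i_def
    by (auto simp: map_le_def map_comp_def total_op_def app_def dom_def split: option.splits)
       (metis option.sel option.exhaust)+
  \<comment> \<open>For a projection P the form at x is the squared norm of P x, so equality of
    forms is equality of norms.\<close>
  have ii_iff: "cond_ii \<longleftrightarrow> (\<forall>f\<in>dom A. \<forall>\<sigma>\<in>sets borel_Rplus.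
      norm (?E\<psi> \<sigma> (app A f)) = norm (?E\<phi> \<sigma> (app absA f)))"
  proof -
    have "cinner (P x) x = of_real ((norm (P x))\<^sup>2)" if "orthogonal_projection P"
      for P and x :: 'a
      using orthogonal_projectionD(3,4)[OF that] cinner_self by metis
    then show ?thesis
      unfolding cond_ii_def
      by (simp add: spectral_measure_projection[OF E\<phi>] spectral_measure_projection[OF E\<psi>]
          of_real_eq_iff del: of_real_power)
  qed
  have iii_iff: "cond_iii \<longleftrightarrow> (\<forall>f\<in>dom A. \<forall>\<sigma>\<in>sets borel_Rplus.
      ?E\<phi> \<sigma> (app absA f) = 0 \<longrightarrow> ?E\<psi> \<sigma> (app A f) = 0)"
  proof -
    have "absolutely_continuous (scalar_measure ?E\<phi> g) (scalar_measure ?E\<psi> h)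
        \<longleftrightarrow> (\<forall>\<sigma>\<in>sets borel_Rplus. ?E\<phi> \<sigma> g = 0 \<longrightarrow> ?E\<psi> \<sigma> h = 0)" for g h
      unfolding absolutely_continuous_def subset_iff
      using null_scalar_measure_iff[OF E\<phi>] null_scalar_measure_iff[OF E\<psi>]
        null_setsD2 space_sets_scalar_measure(2) by metis
    then show ?thesis by (simp add: cond_iii_def)
  qed
  \<comment> \<open>Under (i), the left norm equals that of
    \<open>app A (?E\<phi> \<sigma> f)\<close>, hence that of
    \<open>app absA (?E\<phi> \<sigma> f)\<close>; \<open>commute\<close> then moves the projection
    outside.\<close>
  have "cond_i \<Longrightarrow> cond_ii"
    unfolding i_iff ii_iff using commute norm by metis
  moreover have "cond_ii \<Longrightarrow> cond_iii"
    unfolding ii_iff iii_iff by (metis norm_eq_zero)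
  moreover have "cond_i" if "cond_iii"
    unfolding i_iff
  proof (intro ballI conjI)
    fix \<sigma> f assume \<sigma>: "\<sigma> \<in> sets borel_Rplus" and f: "f \<in> dom A"
    note \<sigma>' = sets_borel_Rplus_Diff[OF \<sigma>]
    let ?f1 = "?E\<phi> \<sigma> f" and ?f2 = "?E\<phi> ({0..} - \<sigma>) f"
    have dom12: "?f1 \<in> dom A" "?f2 \<in> dom A" using commute(1) \<sigma> \<sigma>' f by auto
    show "?f1 \<in> dom A" by (rule dom12)
    \<comment> \<open>By commutation \<open>app absA ?f1\<close> lies in the range of
      \<open>?E\<phi> \<sigma>\<close>, so the complementary projection annihilates it.\<close>
    have "?E\<phi> ({0..} - \<sigma>) (app absA ?f1) = 0"
      unfolding commute(2)[OF \<sigma> f] by (intro spectral_measure_disjoint[OF E\<phi>] \<sigma> \<sigma>') auto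
    then have 1: "?E\<psi> ({0..} - \<sigma>) (app A ?f1) = 0"
      using \<open>cond_iii\<close> \<sigma>' dom12 unfolding iii_iff by blast
    have "?E\<phi> \<sigma> (app absA ?f2) = 0"
      unfolding commute(2)[OF \<sigma>' f] by (intro spectral_measure_disjoint[OF E\<phi>] \<sigma> \<sigma>') auto
    then have 2: "?E\<psi> \<sigma> (app A ?f2) = 0"
      using \<open>cond_iii\<close> \<sigma> dom12 unfolding iii_iff by blast
    have "app A f = app A ?f1 + app A ?f2"
      using assms(3) dom12 spectral_measure_compl[OF E\<phi> \<sigma>, of f] unfolding linear_op_def by metis
    then have "?E\<psi> \<sigma> (app A f) = ?E\<psi> \<sigma> (app A ?f1)"
      by (simp add: P\<psi>[OF \<sigma>] 2)
    then show "app A ?f1 = ?E\<psi> \<sigma> (app A f)"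
      using spectral_measure_compl[OF E\<psi> \<sigma>, of "app A ?f1"] 1 by simp
  qed
  ultimately show ?thesis by blast
qed

end
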